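(* Let $(X,(\|\cdot\|_q)_{q\ge 1})$ be a Fréchet sequence algebra under coordinatewise multiplication in which $(e_n)_{n\ge 0}$ is a basis with Property A. Let $B_w$ be a hypercyclic weighted backward shift on $X$, with weight $w=(w_n)_{n\ge 0}$ and $v_n=\prod_{k=0}^n w_k$. Suppose that there exists an increasing sequence $(p_k)_k$ of natural numbers such that, for each $n\ge 0$, $$v_{p_k+n}^{-1}e_{p_k+n}\to 0 \text{ in } X \text{ as } k\to\infty,$$ and such that, for each $n\ge 0$, $$\prod_{\nu=0}^{p_k+n} w_\nu^{-1}\to 0 \text{ in } \mathbb{C} \text{ as } k\to\infty.$$ Then there exists a point $x\in HC(B_w)$ such that the algebra generated by $x$, except zero, is contained in $HC(B_w)$.
   Context: $\omega$ is the space of all complex sequences $x=(x_n)_{n\ge 0}$ with the topology of coordinatewise convergence; $e_n\in\omega$ is the sequence with $1$ at index $n$ and $0$ elsewhere. Coordinatewise multiplication is $xy=(x_ny_n)_n$. A Fréchet algebra is a complex algebra $X$ that is a (locally convex) Fréchet space whose topology is induced by an increasing sequence $(\|\cdot\|_q)_{q\ge1}$ of seminorms with $\|xy\|_q\le\|x\|_q\|y\|_q$ for all $x,y\in X$, $q\ge1$. A Fréchet sequence algebra under coordinatewise multiplication is a subalgebra $X$ of $\omega$ (with that product) that carries a Fréchet algebra structure such that the embedding $X\hookrightarrow\omega$ is continuous. "Basis" means Schauder basis. Property A of $(e_n)_n$: $X$ contains all $e_n$, and for any $r\ge1$ there are $q\ge1$ and $C>0$ such that $\|e_n\|_r^2\le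 C\|e_n\|_q$ for all $n\ge0$. A weight is a sequence $w=(w_n)_{n\ge0}$ of non-zero complex numbers, with the convention $w_0=1$. The weighted backward shift is $B_w(x_0,x_1,x_2,\dots)=(w_1x_1,w_2x_2,w_3x_3,\dots)$; saying that it is a weighted backward shift on $X$ means that it maps $X$ into $X$ (it is then a continuous linear operator on $X$). For an operator $T$ on $X$, $HC(T)=\{x\in X:\{x,Tx,T^2x,\dots\}\text{ is dense in }X\}$, and $T$ is hypercyclic if $HC(T)\ne\varnothing$. The algebra generated by $x$ is the smallest (not necessarily unital) subalgebra containing $x$, i.e. the set of all finite sums $\sum_{\nu=1}^N c_\nu x^\nu$ with $N\ge 1$ and $c_\nu\in\mathbb{C}$ (powers in the algebra $X$, no constant term). *)

theory Defs
  imports "HOL-Analysis.Analysis" "HOL-Library.Function_Algebras"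
begin

text \<open>
  The space of all complex sequences is the type \<open>nat \<Rightarrow> complex\<close>. Its addition and its
  (coordinatewise) multiplication are those of \<open>HOL-Library.Function_Algebras\<close>; its topology is
  the type-class topology of \<open>HOL-Analysis.Function_Topology\<close>, which is the product topology.
\<close>

type_synonym cseq = "nat \<Rightarrow> complex"

definition cscale :: "complex \<Rightarrow> cseq \<Rightarrow> cseq" (infixr "*\<^sub>s" 75) where
  "c *\<^sub>s x = (\<lambda>n. c * x n)"

interpretation cseq: vector_space cscale
  by unfold_locales (auto simp: cscale_def fun_eq_iff algebra_simps)

definition unit_seq :: "nat \<Rightarrow> cseq" where
  "unit_seq n = (\<lambda>m. if m = n then 1 else 0)"

definition subalgebra :: "cseq set \<Rightarrow> bool" where
  "subalgebra A \<longleftrightarrow> cseq.subspace A \<and> (\<forall>x\<in>A. \<forall>y\<in>A. x * y \<in> A)"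

definition seminorm_on :: "cseq set \<Rightarrow> (cseq \<Rightarrow> real) \<Rightarrow> bool" where
  "seminorm_on X p \<longleftrightarrow>
     (\<forall>x\<in>X. 0 \<le> p x) \<and>
     (\<forall>x\<in>X. \<forall>y\<in>X. p (x + y) \<le> p x + p y) \<and>
     (\<forall>c. \<forall>x\<in>X. p (c *\<^sub>s x) = cmod c * p x)"

text \<open>
  Throughout, a family of seminorms is a function \<open>N\<close> of which only the values \<open>N q\<close> with
  \<open>q \<ge> 1\<close>, at points of \<open>X\<close>, are used.
\<close>

definition seminorm_topology :: "cseq set \<Rightarrow> (nat \<Rightarrow> cseq \<Rightarrow> real) \<Rightarrow> cseq topology" where
  "seminorm_topology X N =
     topology_generated_by {{y \<in> X. N q (y - x) < r} | q x r. 1 \<le> q \<and> x \<in> X \<and> 0 < r}"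

locale frechet_sequence_algebra =
  fixes X :: "cseq set" and N :: "nat \<Rightarrow> cseq \<Rightarrow> real"
  assumes subalgebra: "subalgebra X"
    and seminorm: "\<And>q. 1 \<le> q \<Longrightarrow> seminorm_on X (N q)"
    and increasing: "\<And>q x. \<lbrakk>1 \<le> q; x \<in> X\<rbrakk> \<Longrightarrow> N q x \<le> N (Suc q) x"
    and submultiplicative: "\<And>q x y. \<lbrakk>1 \<le> q; x \<in> X; y \<in> X\<rbrakk> \<Longrightarrow> N q (x * y) \<le> N q x * N q y"
    and separating: "\<And>x. \<lbrakk>x \<in> X; \<And>q. 1 \<le> q \<Longrightarrow> N q x = 0\<rbrakk> \<Longrightarrow> x = 0"
    and complete: "\<And>s :: nat \<Rightarrow> cseq. \<lbrakk>range s \<subseteq> X;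
          \<And>q \<epsilon>. \<lbrakk>1 \<le> q; 0 < \<epsilon>\<rbrakk> \<Longrightarrow> \<exists>M. \<forall>m\<ge>M. \<forall>n\<ge>M. N q (s m - s n) < \<epsilon>\<rbrakk>
          \<Longrightarrow> \<exists>l\<in>X. limitin (seminorm_topology X N) s l sequentially"
    and continuous_embedding: "continuous_map (seminorm_topology X N) euclidean (\<lambda>x. x)"

definition schauder_basis ::
    "cseq set \<Rightarrow> (nat \<Rightarrow> cseq \<Rightarrow> real) \<Rightarrow> (nat \<Rightarrow> cseq) \<Rightarrow> bool" where
  "schauder_basis X N b \<longleftrightarrow> range b \<subseteq> X \<and>
     (\<forall>x\<in>X. \<exists>!a :: nat \<Rightarrow> complex.
        limitin (seminorm_topology X N) (\<lambda>m. \<Sum>n<m. a n *\<^sub>s b n) x sequentially)"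

definition property_A :: "cseq set \<Rightarrow> (nat \<Rightarrow> cseq \<Rightarrow> real) \<Rightarrow> bool" where
  "property_A X N \<longleftrightarrow> range unit_seq \<subseteq> X \<and>
     (\<forall>r\<ge>1. \<exists>q\<ge>1. \<exists>C>0. \<forall>n. (N r (unit_seq n))\<^sup>2 \<le> C * N q (unit_seq n))"

definition weight :: "cseq \<Rightarrow> bool" where
  "weight w \<longleftrightarrow> (\<forall>n. w n \<noteq> 0) \<and> w 0 = 1"

definition backward_shift :: "cseq \<Rightarrow> cseq \<Rightarrow> cseq" where
  "backward_shift w x = (\<lambda>n. w (Suc n) * x (Suc n))"

text \<open>
  Only invariance of \<open>X\<close> is required; continuity on \<open>X\<close> then follows from the closed graph
  theorem.
\<close>

definition weighted_backward_shift_on :: "cseq set \<Rightarrow> cseq \<Rightarrow> bool" where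
  "weighted_backward_shift_on X w \<longleftrightarrow> weight w \<and> backward_shift w ` X \<subseteq> X"

definition HC :: "cseq set \<Rightarrow> (nat \<Rightarrow> cseq \<Rightarrow> real) \<Rightarrow> (cseq \<Rightarrow> cseq) \<Rightarrow> cseq set" where
  "HC X N T = {x \<in> X. seminorm_topology X N closure_of (range (\<lambda>n. (T ^^ n) x)) = X}"

definition hypercyclic :: "cseq set \<Rightarrow> (nat \<Rightarrow> cseq \<Rightarrow> real) \<Rightarrow> (cseq \<Rightarrow> cseq) \<Rightarrow> bool" where
  "hypercyclic X N T \<longleftrightarrow> HC X N T \<noteq> {}"

definition generated_algebra :: "cseq \<Rightarrow> cseq set" where
  "generated_algebra x = subalgebra hull {x}"

text \<open>
  The generated algebra is not unital: it consists of the polynomials in \<open>x\<close> without constant term.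
\<close>

lemma generated_algebra_eq:
  "generated_algebra x =
     {\<Sum>\<nu>=1..M. c \<nu> *\<^sub>s x ^ \<nu> | (c :: nat \<Rightarrow> complex) M. 1 \<le> M}" (is "_ = ?P")
proof
  have ext: "\<exists>d. (\<Sum>\<nu>=1..M. c \<nu> *\<^sub>s x ^ \<nu>) = (\<Sum>\<nu>=1..M'. d \<nu> *\<^sub>s x ^ \<nu>)" if "M \<le> M'"
    for c :: "nat \<Rightarrow> complex" and M M'
    by (rule exI[of _ "\<lambda>\<nu>. if \<nu> \<le> M then c \<nu> else 0"], rule sum.mono_neutral_cong_left)
       (use that in \<open>auto simp: cscale_def fun_eq_iff\<close>)
  have zero: "0 \<in> ?P"
    by (rule CollectI, rule exI[of _ "\<lambda>_. 0"], rule exI[of _ 1]) simp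
  have add: "y + z \<in> ?P" if y: "y \<in> ?P" and z: "z \<in> ?P" for y z
  proof -
    from y obtain c M where M: "1 \<le> M" "y = (\<Sum>\<nu>=1..M. c \<nu> *\<^sub>s x ^ \<nu>)" by blast
    from z obtain d K where K: "1 \<le> K" "z = (\<Sum>\<nu>=1..K. d \<nu> *\<^sub>s x ^ \<nu>)" by blast
    obtain c' where c': "y = (\<Sum>\<nu>=1..max M K. c' \<nu> *\<^sub>s x ^ \<nu>)"
      using ext[of M "max M K" c] M by auto
    obtain d' where d': "z = (\<Sum>\<nu>=1..max M K. d' \<nu> *\<^sub>s x ^ \<nu>)"
      using ext[of K "max M K" d] K by auto
    have "y + z = (\<Sum>\<nu>=1..max M K. (c' \<nu> + d' \<nu>) *\<^sub>s x ^ \<nu>)"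
      by (simp add: c' d' sum.distrib cseq.scale_left_distrib)
    then show ?thesis
      using M(1) by (intro CollectI exI[of _ "\<lambda>\<nu>. c' \<nu> + d' \<nu>"] exI[of _ "max M K"]) auto
  qed
  have scale: "a *\<^sub>s y \<in> ?P" if y: "y \<in> ?P" for a y
  proof -
    from y obtain c M where M: "1 \<le> M" "y = (\<Sum>\<nu>=1..M. c \<nu> *\<^sub>s x ^ \<nu>)" by blast
    have "a *\<^sub>s y = (\<Sum>\<nu>=1..M. (a * c \<nu>) *\<^sub>s x ^ \<nu>)"
      by (simp add: M(2) cseq.scale_sum_right)
    then show ?thesis using M(1) by (intro CollectI exI[of _ "\<lambda>\<nu>. a * c \<nu>"] exI[of _ M]) auto
  qed
  have sub: "cseq.subspace ?P"
    unfolding cseq.subspace_def using zero add scale by blast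
  have pow: "x ^ n \<in> ?P" if "1 \<le> n" for n
  proof -
    have "x ^ n = (\<Sum>\<nu>=1..n. (if \<nu> = n then 1 else 0) *\<^sub>s x ^ \<nu>)"
      using that by (simp add: if_distrib[of "\<lambda>t. t *\<^sub>s _"] cong: if_cong)
    then show ?thesis
      using that by (intro CollectI exI[of _ "\<lambda>\<nu>. if \<nu> = n then 1 else 0"] exI[of _ n]) auto
  qed
  have mult: "y * z \<in> ?P" if y: "y \<in> ?P" and z: "z \<in> ?P" for y z
  proof -
    from y obtain c M where M: "1 \<le> M" "y = (\<Sum>\<nu>=1..M. c \<nu> *\<^sub>s x ^ \<nu>)" by blast
    from z obtain d K where K: "1 \<le> K" "z = (\<Sum>\<nu>=1..K. d \<nu> *\<^sub>s x ^ \<nu>)" by blast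
    have sm: "(a *\<^sub>s u) * (b *\<^sub>s v) = (a * b) *\<^sub>s (u * v)" for a b u v
      by (simp add: cscale_def fun_eq_iff)
    have "y * z = (\<Sum>i=1..M. \<Sum>j=1..K. (c i * d j) *\<^sub>s x ^ (i + j))"
      by (simp add: M(2) K(2) sum_product sm power_add)
    also have "\<dots> \<in> ?P"
      by (intro cseq.subspace_sum[OF sub] cseq.subspace_scale[OF sub] pow) auto
    finally show ?thesis .
  qed
  have "subalgebra ?P"
    unfolding subalgebra_def using sub mult by blast
  moreover have "{x} \<subseteq> ?P"
    using pow[of 1] by simp
  ultimately show "generated_algebra x \<subseteq> ?P"
    unfolding generated_algebra_def by (intro hull_minimal)
  show "?P \<subseteq> generated_algebra x"
    unfolding generated_algebra_def hull_def
  proof (rule Inter_greatest)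
    fix A assume "A \<in> {t. subalgebra t \<and> {x} \<subseteq> t}"
    then have A: "cseq.subspace A" "\<And>y z. y \<in> A \<Longrightarrow> z \<in> A \<Longrightarrow> y * z \<in> A" "x \<in> A"
      by (auto simp: subalgebra_def)
    have powA: "x ^ n \<in> A" if "1 \<le> n" for n
      using that
    proof (induction n rule: dec_induct)
      case base then show ?case using A(3) by simp
    next
      case (step n) then show ?case using A(2,3) unfolding power_Suc by blast
    qed
    show "?P \<subseteq> A"
      by (auto intro!: cseq.subspace_sum[OF A(1)] cseq.subspace_scale[OF A(1)] powA)
  qed
qed

end

theory Submission
  imports Defs
begin

text \<open>
  Put \<open>x\<^sub>n = (y\<^sub>j v\<^sub>j / v\<^sub>n)\<^bsup>1/\<nu>\<^esup>\<close> at the indices \<open>n = b + j\<close> of sparse blocks based at suitable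
  \<open>b = p\<^sub>k\<close>, where the finite sequence \<open>y\<close> and the exponent \<open>\<nu>\<close> run through a countable dense
  family, each pair recurring infinitely often. The shift by \<open>b\<close> steps sends \<open>x\<^sup>\<nu>\<close> to \<open>y\<close>, up to the
  later blocks. Higher powers are negligible because \<open>1/v\<^sub>n\<close> tends to 0, so a polynomial in \<open>x\<close> is
  governed by its term of lowest degree. Property A turns \<open>e\<^sub>n / v\<^sub>n \<rightarrow> 0\<close> into the same statement
  for roots of \<open>1/v\<^sub>n\<close>, which places \<open>x\<close> in \<open>X\<close> and makes the later blocks negligible.
\<close>

section \<open>Coordinates, iterates of the shift, and complex roots\<close>

lemma cscale_apply [simp]: "(c *\<^sub>s x) i = c * x i"
  by (simp add: cscale_def)

lemma unit_seq_apply: "unit_seq n i = (if i = n then 1 else 0)"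
  by (simp add: unit_seq_def)

lemma sum_apply: "(\<Sum>n\<in>I. f n) i = (\<Sum>n\<in>I. f n i)"
  for f :: "'a \<Rightarrow> 'b \<Rightarrow> 'c::comm_monoid_add"
  by (induction I rule: infinite_finite_induct) auto

lemma power_fun_apply: "(x ^ n) i = x i ^ n"
  for x :: "'a \<Rightarrow> 'b::monoid_mult"
  by (induction n) auto

lemma sum_unit_seq_apply:
  "(\<Sum>n<K. a n *\<^sub>s unit_seq n) i = (if i < K then a i else 0)"
  by (simp add: sum_apply unit_seq_apply if_distrib cong: if_cong)

text \<open>Each weight is a quotient \<open>w (Suc n) = v (Suc n) / v n\<close> of consecutive
  products, so the weights met along the iteration telescope.\<close>

lemma backward_shift_funpow:
  assumes "weight w" and v: "\<And>n. v n = (\<Prod>k=0..n. w k)"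
  shows "(backward_shift w ^^ m) x n = v (n + m) / v n * x (n + m)"
proof (induction m arbitrary: n)
  case 0
  have "v n \<noteq> 0" using assms(1) by (simp add: v weight_def)
  then show ?case by simp
next
  case (Suc m)
  have nz: "v n \<noteq> 0" "v (Suc n) \<noteq> 0" for n using assms(1) by (simp_all add: v weight_def)
  have "v (Suc n) = v n * w (Suc n)" by (simp add: v)
  then have "w (Suc n) = v (Suc n) / v n" using nz by simp
  then show ?case using nz Suc[of "Suc n"] by (simp add: backward_shift_def)
qed

lemma exists_nth_root_complex:
  assumes "0 < n"
  shows "\<exists>r::complex. r ^ n = z"
proof (cases "z = 0")
  case False
  then have "(exp (Ln z / of_nat n)) ^ n = z"
    using assms by (simp flip: exp_of_nat_mult)
  then show ?thesis by blast
qed (use assms in auto)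

text \<open>The branch is immaterial: later arguments use only the n-th power and the modulus that
  it determines, so an arbitrary choice suffices.\<close>

definition some_root :: "nat \<Rightarrow> complex \<Rightarrow> complex" where
  "some_root n z = (SOME r. r ^ n = z)"

lemma some_root_power: "0 < n \<Longrightarrow> some_root n z ^ n = z"
  unfolding some_root_def using exists_nth_root_complex by (rule someI_ex)

lemma tendsto_zero_of_power:
  fixes f :: "'a \<Rightarrow> real"
  assumes "((\<lambda>k. f k ^ n) \<longlongrightarrow> 0) F" "\<And>k. 0 \<le> f k"
  shows "(f \<longlongrightarrow> 0) F"
proof (rule tendstoI)
  fix e :: real assume "0 < e"
  then have "eventually (\<lambda>k. dist (f k ^ n) 0 < e ^ n) F"
    by (intro tendstoD[OF assms(1)]) simp
  then show "eventually (\<lambda>k. dist (f k) 0 < e) F"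
    by eventually_elim (use assms(2) \<open>0 < e\<close> in \<open>auto intro: power_less_imp_less_base[of _ n]\<close>)
qed

section \<open>Seminorm calculus and the topology generated by the seminorms\<close>

context frechet_sequence_algebra
begin

lemma subspace: "cseq.subspace X"
  using subalgebra by (simp add: subalgebra_def)

lemma mult_mem: "x \<in> X \<Longrightarrow> y \<in> X \<Longrightarrow> x * y \<in> X"
  using subalgebra by (simp add: subalgebra_def)

lemmas mem_intros = cseq.subspace_0[OF subspace] cseq.subspace_add[OF subspace]
  cseq.subspace_diff[OF subspace] cseq.subspace_scale[OF subspace] cseq.subspace_sum[OF subspace]

lemma seminorm_nonneg: "1 \<le> q \<Longrightarrow> x \<in> X \<Longrightarrow> 0 \<le> N q x"
  and seminorm_triangle: "1 \<le> q \<Longrightarrow> x \<in> X \<Longrightarrow> y \<in> X \<Longrightarrow> N q (x + y) \<le> N q x + N q y"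
  and seminorm_scale: "1 \<le> q \<Longrightarrow> x \<in> X \<Longrightarrow> N q (c *\<^sub>s x) = cmod c * N q x"
  using seminorm[of q] by (auto simp: seminorm_on_def)

lemma seminorm_zero: "1 \<le> q \<Longrightarrow> N q 0 = 0"
  using seminorm_scale[of q 0 0] mem_intros(1) by simp

lemma seminorm_minus:
  assumes "1 \<le> q" "x \<in> X" "y \<in> X"
  shows "N q (x - y) = N q (y - x)"
proof -
  have "x - y = (- 1) *\<^sub>s (y - x)" by (auto simp: cscale_def)
  then show ?thesis using seminorm_scale[of q "y - x" "- 1"] assms mem_intros(3) by simp
qed

lemma seminorm_triangle_diff:
  assumes "1 \<le> q" "x \<in> X" "y \<in> X" "z \<in> X"
  shows "N q (x - z) \<le> N q (x - y) + N q (y - z)"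
  using seminorm_triangle[of q "x - y" "y - z"] assms mem_intros(3) by simp

lemma seminorm_mono:
  assumes "1 \<le> q" "q \<le> q'" "x \<in> X"
  shows "N q x \<le> N q' x"
  using assms(2)
proof (induction rule: dec_induct)
  case (step n)
  then show ?case using increasing[of n x] assms by simp
qed simp

lemma seminorm_sum:
  assumes "1 \<le> q" "\<And>i. i \<in> I \<Longrightarrow> f i \<in> X"
  shows "N q (\<Sum>i\<in>I. f i) \<le> (\<Sum>i\<in>I. N q (f i))"
  using assms(2)
proof (induction I rule: infinite_finite_induct)
  case (insert i I)
  have "N q (f i + (\<Sum>i\<in>I. f i)) \<le> N q (f i) + N q (\<Sum>i\<in>I. f i)"
    using insert.prems by (intro seminorm_triangle assms(1) mem_intros) auto
  moreover have "N q (\<Sum>i\<in>I. f i) \<le> (\<Sum>i\<in>I. N q (f i))" using insert by blast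
  ultimately show ?case unfolding sum.insert[OF insert.hyps] by linarith
qed (use seminorm_zero[OF assms(1)] in simp_all)

lemma topspace_seminorm_topology [simp]: "topspace (seminorm_topology X N) = X"
proof -
  have "x \<in> \<Union> {{y \<in> X. N q (y - x) < r} | q x r. 1 \<le> q \<and> x \<in> X \<and> 0 < r}" if "x \<in> X" for x
    using that seminorm_zero[of 1]
    by (intro UnionI[of "{y \<in> X. N 1 (y - x) < 1}"] CollectI exI[of _ 1] exI[of _ x]) auto
  then show ?thesis
    unfolding seminorm_topology_def topology_generated_by_topspace by blast
qed

lemma openin_ball:
  assumes "1 \<le> q" "x \<in> X" "0 < r"
  shows "openin (seminorm_topology X N) {y \<in> X. N q (y - x) < r}"
  unfolding seminorm_topology_def by (rule topology_generated_by_Basis) (use assms in blast)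

text \<open>The defining balls, with arbitrary centres, are only a subbase. The triangle inequality
  recentres each of them at \<open>z\<close>; since the seminorms increase, the larger index with
  the smaller radius handles an intersection of two open sets.\<close>

lemma openin_contains_ball:
  assumes "openin (seminorm_topology X N) U" "z \<in> U"
  obtains q r where "1 \<le> q" "0 < r" "{y \<in> X. N q (y - z) < r} \<subseteq> U"
proof -
  have "generate_topology_on {{y \<in> X. N q (y - x) < r} | q x r. 1 \<le> q \<and> x \<in> X \<and> 0 < r} U"
    using assms(1) by (simp add: seminorm_topology_def openin_topology_generated_by_iff)
  then have "\<exists>q r. 1 \<le> q \<and> 0 < r \<and> {y \<in> X. N q (y - z) < r} \<subseteq> U"
    using assms(2)
  proof (induction)
    case (Int a b)
    then obtain q r q' r' where *: "1 \<le> q" "0 < r" "{y \<in> X. N q (y - z) < r} \<subseteq> a"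
      "1 \<le> q'" "0 < r'" "{y \<in> X. N q' (y - z) < r'} \<subseteq> b" by blast
    have "z \<in> X"
      using Int.hyps(1) Int.prems topspace_seminorm_topology
      unfolding openin_topology_generated_by_iff[symmetric] seminorm_topology_def[symmetric]
      using openin_subset by fastforce
    have "y \<in> a \<inter> b" if "y \<in> X" "N (max q q') (y - z) < min r r'" for y
    proof -
      have "y - z \<in> X" using that \<open>z \<in> X\<close> by (intro mem_intros)
      then have "N q (y - z) \<le> N (max q q') (y - z)" "N q' (y - z) \<le> N (max q q') (y - z)"
        using seminorm_mono[of q "max q q'"] seminorm_mono[of q' "max q q'"] *(1,4) by auto
      then have "N q (y - z) < r" "N q' (y - z) < r'" using that(2) by simp_all
      then show ?thesis using *(3,6) that(1) by blast
    qed
    then have "{y \<in> X. N (max q q') (y - z) < min r r'} \<subseteq> a \<inter> b" by blast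
    moreover have "1 \<le> max q q'" "0 < min r r'" using * by auto
    ultimately show ?case by blast
  next
    case (UN K)
    then obtain k where "k \<in> K" "z \<in> k" by blast
    with UN.IH[of k] show ?case by blast
  next
    case (Basis s)
    then obtain q x r where *: "1 \<le> q" "x \<in> X" "0 < r" and s: "s = {y \<in> X. N q (y - x) < r}"
      by blast
    have "{y \<in> X. N q (y - z) < r - N q (z - x)} \<subseteq> s"
      using seminorm_triangle_diff[of q _ z x] * Basis.prems by (force simp: s)
    moreover have "0 < r - N q (z - x)" using Basis.prems by (simp add: s)
    ultimately show ?case using *(1) by blast
  qed simp
  then show ?thesis using that by blast
qed

lemma limitinD:
  assumes "limitin (seminorm_topology X N) s l F" "1 \<le> q" "0 < e"
  shows "eventually (\<lambda>k. s k \<in> X \<and> N q (s k - l) < e) F"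
proof -
  have "l \<in> X" using assms(1) by (simp add: limitin_def)
  then have "openin (seminorm_topology X N) {y \<in> X. N q (y - l) < e}"
    "l \<in> {y \<in> X. N q (y - l) < e}"
    using assms by (auto intro: openin_ball simp: seminorm_zero)
  with assms(1) have "eventually (\<lambda>k. s k \<in> {y \<in> X. N q (y - l) < e}) F"
    unfolding limitin_def by blast
  then show ?thesis by simp
qed

lemma limitin_apply:
  assumes "limitin (seminorm_topology X N) s l F"
  shows "((\<lambda>k. s k i) \<longlongrightarrow> l i) F"
proof -
  have "limitin euclidean ((\<lambda>x. x) \<circ> s) l F"
    using continuous_map_limit[OF continuous_embedding assms] by simp
  then have "(s \<longlongrightarrow> l) F" by (simp add: o_def)
  then show ?thesis
    using continuous_on_tendsto_compose[OF continuous_on_product_coordinates, of s l F i] by simp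
qed

lemma closure_of_eq_carrier:
  assumes "S \<subseteq> X"
    and "\<And>z q e. z \<in> X \<Longrightarrow> 1 \<le> q \<Longrightarrow> 0 < e \<Longrightarrow> \<exists>y\<in>S. N q (y - z) < e"
  shows "seminorm_topology X N closure_of S = X"
proof -
  have "z \<in> seminorm_topology X N closure_of S" if "z \<in> X" for z
    unfolding in_closure_of
  proof (intro conjI allI impI)
    fix U assume U: "z \<in> U \<and> openin (seminorm_topology X N) U"
    obtain q r where "1 \<le> q" "0 < r" "{y \<in> X. N q (y - z) < r} \<subseteq> U"
      by (rule openin_contains_ball[of U z]) (use U in blast)+
    then show "\<exists>y. y \<in> S \<and> y \<in> U"
      using assms(2)[OF that, of q r] assms(1) by blast
  qed (use that in simp)
  then show ?thesis using closure_of_subset_topspace by fastforce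
qed

end

section \<open>Basis expansions, continuity of the shift, and consequences of Property A\<close>

locale weighted_shift_algebra = frechet_sequence_algebra X N
  for X :: "cseq set" and N :: "nat \<Rightarrow> cseq \<Rightarrow> real" +
  fixes w v :: "nat \<Rightarrow> complex"
  assumes basis: "schauder_basis X N unit_seq"
    and property_A: "property_A X N"
    and shift: "weighted_backward_shift_on X w"
    and v_eq: "\<And>n. v n = (\<Prod>k=0..n. w k)"
begin

definition E :: "nat \<Rightarrow> nat \<Rightarrow> real" where
  "E q n = N q (unit_seq n)"

lemma unit_seq_mem [simp]: "unit_seq n \<in> X"
  using basis by (auto simp: schauder_basis_def)

lemma E_nonneg: "1 \<le> q \<Longrightarrow> 0 \<le> E q n"
  by (simp add: E_def seminorm_nonneg)

lemma E_mono: "1 \<le> q \<Longrightarrow> q \<le> q' \<Longrightarrow> E q n \<le> E q' n"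
  by (simp add: E_def seminorm_mono)

lemma v_nonzero [simp]: "v n \<noteq> 0"
  using shift by (simp add: v_eq weighted_backward_shift_on_def weight_def)

lemma funpow_shift_apply: "(backward_shift w ^^ m) x n = v (n + m) / v n * x (n + m)"
  using shift by (intro backward_shift_funpow v_eq) (simp add: weighted_backward_shift_on_def)

lemma funpow_shift_mem: "x \<in> X \<Longrightarrow> (backward_shift w ^^ m) x \<in> X"
  using shift by (induction m) (auto simp: weighted_backward_shift_on_def)

lemma sum_unit_seq_mem: "(\<Sum>n\<in>I. a n *\<^sub>s unit_seq n) \<in> X"
  by (intro mem_intros unit_seq_mem)

text \<open>The basis provides some coefficient sequence; continuity of the coordinates identifies
  it with \<open>z\<close>, since each coordinate of the partial sums is eventually
  constant.\<close>

lemma expansion: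
  assumes "z \<in> X"
  shows "limitin (seminorm_topology X N) (\<lambda>m. \<Sum>n<m. z n *\<^sub>s unit_seq n) z sequentially"
proof -
  obtain a where a: "limitin (seminorm_topology X N) (\<lambda>m. \<Sum>n<m. a n *\<^sub>s unit_seq n) z sequentially"
    using basis assms unfolding schauder_basis_def by blast
  have "a i = z i" for i
  proof (rule LIMSEQ_unique[OF _ limitin_apply[OF a, of i]])
    show "(\<lambda>m. (\<Sum>n<m. a n *\<^sub>s unit_seq n) i) \<longlonglongrightarrow> a i"
      by (rule tendsto_eventually, rule eventually_sequentiallyI[of "Suc i"])
         (simp add: sum_unit_seq_apply)
  qed
  then have "a = z" by blast
  with a show ?thesis by simp
qed

lemma seminorm_sum_unit_seq_le:
  assumes "1 \<le> q"
  shows "N q (\<Sum>n\<in>I. a n *\<^sub>s unit_seq n) \<le> (\<Sum>n\<in>I. cmod (a n) * E q n)"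
proof -
  have "N q (\<Sum>n\<in>I. a n *\<^sub>s unit_seq n) \<le> (\<Sum>n\<in>I. N q (a n *\<^sub>s unit_seq n))"
    by (intro seminorm_sum assms mem_intros unit_seq_mem)
  then show ?thesis by (simp only: seminorm_scale[OF assms unit_seq_mem] E_def)
qed

text \<open>The partial sums of the expansion obey the bound by the triangle inequality, and it
  survives the limit. This reduces the estimate for the orbit of a polynomial to single
  coordinates.\<close>

lemma seminorm_le_of_coordinates:
  assumes "z \<in> X" "1 \<le> q" "\<And>K. (\<Sum>n<K. cmod (z n) * E q n) \<le> B"
  shows "N q z \<le> B"
proof (rule field_le_epsilon)
  fix e :: real assume "0 < e"
  define S where "S K = (\<Sum>n<K. z n *\<^sub>s unit_seq n)" for K
  have S: "S K \<in> X" for K unfolding S_def by (rule sum_unit_seq_mem)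
  obtain K where "N q (S K - z) < e"
    using limitinD[OF expansion[OF assms(1)] assms(2) \<open>0 < e\<close>]
    unfolding eventually_sequentially S_def by blast
  moreover have "N q (S K) \<le> B"
    using seminorm_sum_unit_seq_le[OF assms(2), of z "{..<K}"] assms(3)[of K] by (simp add: S_def)
  moreover have "N q z \<le> N q (z - S K) + N q (S K)"
    using seminorm_triangle_diff[OF assms(2,1) S, of 0 K] mem_intros(1) by simp
  ultimately show "N q z \<le> B + e"
    using seminorm_minus[OF assms(2,1) S, of K] by linarith
qed

text \<open>A term of the expansion is the difference of two consecutive partial sums, both of which
  are close to \<open>z\<close>.\<close>

lemma coordinates_tendsto_zero:
  assumes "z \<in> X" "1 \<le> q"
  shows "(\<lambda>n. cmod (z n) * E q n) \<longlonglongrightarrow> 0"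
proof (rule tendstoI)
  fix e :: real assume "0 < e"
  define S where "S K = (\<Sum>n<K. z n *\<^sub>s unit_seq n)" for K
  have S: "S K \<in> X" for K unfolding S_def by (rule sum_unit_seq_mem)
  have ev: "eventually (\<lambda>K. N q (S K - z) < e / 2) sequentially"
    using limitinD[OF expansion[OF assms(1)] assms(2), of "e / 2"] \<open>0 < e\<close>
    unfolding S_def by (auto elim: eventually_mono)
  then have "eventually (\<lambda>K. N q (S (Suc K) - z) < e / 2) sequentially"
    by (rule eventually_compose_filterlim[OF _ filterlim_Suc])
  with ev show "eventually (\<lambda>n. dist (cmod (z n) * E q n) 0 < e) sequentially"
  proof eventually_elim
    case (elim n)
    have "N q (z n *\<^sub>s unit_seq n) = N q (S (Suc n) - S n)" by (simp add: S_def)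
    also have "\<dots> \<le> N q (S (Suc n) - z) + N q (z - S n)"
      by (rule seminorm_triangle_diff) (use assms S in auto)
    also have "\<dots> < e" using elim seminorm_minus[OF assms(2,1) S, of n] by linarith
    finally show ?case
      using E_nonneg[OF assms(2)] by (simp add: seminorm_scale[OF assms(2)] E_def[symmetric])
  qed
qed

text \<open>Absolute summability makes the partial sums Cauchy in every seminorm; completeness gives
  a limit in \<open>X\<close>, whose coordinates must be those of \<open>z\<close>. Vectors built
  coordinate by coordinate are placed in \<open>X\<close> in this way.\<close>

lemma mem_of_summable:
  assumes "\<And>q. 1 \<le> q \<Longrightarrow> summable (\<lambda>n. cmod (z n) * E q n)"
  shows "z \<in> X"
proof -
  define S where "S K = (\<Sum>n<K. z n *\<^sub>s unit_seq n)" for K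
  have S: "S K \<in> X" for K unfolding S_def by (rule sum_unit_seq_mem)
  have diff: "N q (S n - S m) \<le> (\<Sum>i=m..<n. cmod (z i) * E q i)" if "1 \<le> q" "m \<le> n" for q m n
  proof -
    have "S n - S m = (\<Sum>i=m..<n. z i *\<^sub>s unit_seq i)"
      using sum_diff_nat_ivl[of 0 m n "\<lambda>i. z i *\<^sub>s unit_seq i"] that
      by (simp only: S_def atLeast0LessThan)
    then show ?thesis using seminorm_sum_unit_seq_le[OF that(1), of z "{m..<n}"] by simp
  qed
  have "\<exists>l\<in>X. limitin (seminorm_topology X N) S l sequentially"
  proof (rule complete)
    fix q :: nat and e :: real assume q: "1 \<le> q" and "0 < e"
    then obtain M where M: "\<And>m n. M \<le> m \<Longrightarrow> norm (\<Sum>i=m..<n. cmod (z i) * E q i) < e"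
      using assms[OF q] unfolding summable_Cauchy by blast
    have le: "N q (S n - S m) < e" if "M \<le> m" "m \<le> n" for m n
      using diff[OF q that(2)] M[OF that(1), of n] by simp
    have "N q (S m - S n) < e" if "M \<le> m" "M \<le> n" for m n
      using le[of m n] le[of n m] seminorm_minus[OF q S S, of m n] that by (cases "m \<le> n") auto
    then show "\<exists>M. \<forall>m\<ge>M. \<forall>n\<ge>M. N q (S m - S n) < e" by blast
  qed (use S in blast)
  then obtain l where l: "l \<in> X" "limitin (seminorm_topology X N) S l sequentially" by blast
  have "z i = l i" for i
  proof (rule LIMSEQ_unique[OF _ limitin_apply[OF l(2), of i]])
    show "(\<lambda>m. S m i) \<longlonglongrightarrow> z i"
      by (rule tendsto_eventually, rule eventually_sequentiallyI[of "Suc i"])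
         (simp add: sum_unit_seq_apply S_def)
  qed
  then have "z = l" by blast
  with l show ?thesis by simp
qed

text \<open>
  Continuity of \<open>B\<^sub>w\<^sup>m\<close> on the basis vectors, obtained by a gliding hump instead of the closed graph
  theorem: a violation along a sequence of indices would give an element of \<open>X\<close> whose image has
  coordinates not tending to zero.
\<close>
lemma shift_bound:
  assumes "1 \<le> q"
  shows "\<exists>q'\<ge>1. \<exists>C>0. \<exists>M. \<forall>n\<ge>M. cmod (v n / v (n - m)) * E q (n - m) \<le> C * E q' n"
proof (rule ccontr)
  assume contra: "\<not> ?thesis"
  define D where "D n = cmod (v n / v (n - m)) * E q (n - m)" for n
  have ex: "\<exists>n\<ge>M. C * E q' n < D n" if "1 \<le> q'" "0 < C" for q' C M
    using contra that unfolding D_def by (meson not_le)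
  \<comment> \<open>The i-th index violates the bound for the seminorm \<open>Suc i\<close> and the
    constant \<open>2 ^ i\<close>: every seminorm is eventually covered, and
    \<open>E (Suc i) (f i) / D (f i)\<close> decays geometrically.\<close>
  have "\<exists>f. \<forall>i. (m \<le> f i \<and> 2 ^ i * E (Suc i) (f i) < D (f i)) \<and> f i < f (Suc i)"
  proof (rule dependent_nat_choice)
    show "\<exists>n. m \<le> n \<and> 2 ^ 0 * E (Suc 0) n < D n" using ex[of 1 1 m] by auto
    show "\<exists>y. (m \<le> y \<and> 2 ^ Suc i * E (Suc (Suc i)) y < D y) \<and> n < y" for n i
    proof -
      obtain y where "max m (Suc n) \<le> y" "2 ^ Suc i * E (Suc (Suc i)) y < D y"
        using ex[of "Suc (Suc i)" "2 ^ Suc i" "max m (Suc n)"] by auto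
      then show ?thesis by (intro exI[of _ y]) auto
    qed
  qed
  then obtain f where f: "\<And>i. m \<le> f i" "\<And>i. 2 ^ i * E (Suc i) (f i) < D (f i)"
    and "\<And>i. f i < f (Suc i)" by blast
  then have sm: "strict_mono f" by (simp add: strict_mono_Suc_iff)
  have Dpos: "0 < D (f i)" for i
    using f(2)[of i] E_nonneg[of "Suc i" "f i"] by (smt (verit) le_add1 mult_nonneg_nonneg plus_1_eq_Suc zero_le_power)
  \<comment> \<open>The value \<open>1 / D n\<close> normalises the humps: after \<open>m\<close>
    shifts each of them has size exactly 1 when measured with \<open>E q\<close>.\<close>
  define z :: cseq where "z n = (if n \<in> range f then of_real (1 / D n) else 0)" for n
  have "z \<in> X"
  proof (rule mem_of_summable)
    fix r :: nat assume r: "1 \<le> r"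
    have "summable (\<lambda>i. cmod (z (f i)) * E r (f i))"
    proof (rule summable_comparison_test_ev)
      show "eventually (\<lambda>i. norm (cmod (z (f i)) * E r (f i)) \<le> (1/2) ^ i) sequentially"
      proof (rule eventually_sequentiallyI)
        fix i assume "r \<le> i"
        then have "2 ^ i * E r (f i) \<le> 2 ^ i * E (Suc i) (f i)"
          using r by (intro mult_left_mono E_mono) auto
        with f(2)[of i] have "2 ^ i * E r (f i) \<le> D (f i)" by linarith
        then show "norm (cmod (z (f i)) * E r (f i)) \<le> (1/2) ^ i"
          using Dpos[of i] E_nonneg[OF r, of "f i"]
          by (simp add: z_def field_simps norm_divide)
      qed
    qed (simp add: summable_geometric)
    then show "summable (\<lambda>n. cmod (z n) * E r n)"
      by (subst (asm) summable_mono_reindex[OF sm]) (auto simp: z_def)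
  qed
  then have "(\<lambda>n. cmod ((backward_shift w ^^ m) z n) * E q n) \<longlonglongrightarrow> 0"
    by (intro coordinates_tendsto_zero funpow_shift_mem assms)
  moreover have "filterlim (\<lambda>i. f i - m) at_top sequentially"
    by (rule filterlim_compose[OF filterlim_minus_const_nat_at_top filterlim_subseq[OF sm]])
  ultimately have "(\<lambda>i. cmod ((backward_shift w ^^ m) z (f i - m)) * E q (f i - m)) \<longlonglongrightarrow> 0"
    by (rule filterlim_compose)
  \<comment> \<open>The hump at \<open>f i\<close> lands at \<open>f i - m\<close>, where the
    truncated subtraction is exact because \<open>m \<le> f i\<close>.\<close>
  moreover have "cmod ((backward_shift w ^^ m) z (f i - m)) * E q (f i - m) = 1" for i
  proof -
    have "cmod ((backward_shift w ^^ m) z (f i - m)) * E q (f i - m) = D (f i) * cmod (z (f i))"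
      using f(1)[of i] by (simp add: funpow_shift_apply D_def norm_mult norm_divide)
    then show ?thesis using Dpos[of i] by (simp add: z_def norm_divide)
  qed
  ultimately show False by (simp add: LIMSEQ_const_iff)
qed

text \<open>Each step squares the inequality and applies Property A to its right-hand side.
  Exponents that are powers of 2 are enough, because \<open>2 ^ \<nu>\<close> exceeds \<nu>.\<close>

lemma property_A_iterate:
  assumes "1 \<le> r"
  shows "\<exists>q\<ge>1. \<exists>C>0. \<forall>n. E r n ^ (2 ^ t) \<le> C * E q n"
  using assms
proof (induction t arbitrary: r)
  case 0
  then show ?case by (intro exI[of _ r] conjI exI[of _ 1]) auto
next
  case (Suc t)
  then obtain q C where q: "1 \<le> q" "0 < C" "\<And>n. E r n ^ (2 ^ t) \<le> C * E q n" by blast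
  obtain q' C' where q': "1 \<le> q'" "0 < C'" "\<And>n. (E q n)\<^sup>2 \<le> C' * E q' n"
    using property_A q(1) unfolding property_A_def E_def by blast
  have "E r n ^ (2 ^ Suc t) \<le> (C\<^sup>2 * C') * E q' n" for n
  proof -
    have "E r n ^ (2 ^ Suc t) = (E r n ^ (2 ^ t))\<^sup>2"
      by (simp flip: power_mult add: mult.commute)
    also have "\<dots> \<le> (C * E q n)\<^sup>2"
      using q(3)[of n] E_nonneg[OF Suc.prems] by (intro power_mono) auto
    also have "\<dots> \<le> C\<^sup>2 * (C' * E q' n)"
      using q'(3)[of n] q(2) by (simp add: power_mult_distrib)
    finally show ?thesis by simp
  qed
  then show ?case using q q' by (intro exI[of _ q'] conjI exI[of _ "C\<^sup>2 * C'"]) auto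
qed

lemma roots_tendsto_zero:
  fixes a :: "nat \<Rightarrow> nat" and \<xi> :: "nat \<Rightarrow> complex"
  assumes a: "\<And>q. 1 \<le> q \<Longrightarrow> (\<lambda>k. cmod (inverse (v (a k))) * E q (a k)) \<longlonglongrightarrow> 0"
    and v: "(\<lambda>k. inverse (v (a k))) \<longlonglongrightarrow> 0"
    and "0 < \<nu>" and \<xi>: "\<And>k. cmod (\<xi> k) ^ \<nu> = B * cmod (inverse (v (a k)))"
    and "1 \<le> r"
  shows "(\<lambda>k. cmod (\<xi> k)) \<longlonglongrightarrow> 0" "(\<lambda>k. cmod (\<xi> k) * E r (a k)) \<longlonglongrightarrow> 0"
proof -
  have "(\<lambda>k. B * cmod (inverse (v (a k)))) \<longlonglongrightarrow> B * 0"
    by (intro tendsto_mult_left tendsto_norm_zero v)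
  then have "(\<lambda>k. cmod (\<xi> k) ^ \<nu>) \<longlonglongrightarrow> 0" by (simp add: \<xi>)
  then show \<xi>0: "(\<lambda>k. cmod (\<xi> k)) \<longlonglongrightarrow> 0" by (rule tendsto_zero_of_power) simp
  obtain q C where q: "1 \<le> q" "0 < C" "\<And>n. E r n ^ (2 ^ \<nu>) \<le> C * E q n"
    using property_A_iterate[OF \<open>1 \<le> r\<close>] by blast
  have "(\<lambda>k. (cmod (\<xi> k) * E r (a k)) ^ (2 ^ \<nu>)) \<longlonglongrightarrow> 0"
  proof (rule tendsto_sandwich)
    show "eventually (\<lambda>k. 0 \<le> (cmod (\<xi> k) * E r (a k)) ^ (2 ^ \<nu>)) sequentially"
      using E_nonneg[OF \<open>1 \<le> r\<close>] by simp
    have "(\<lambda>k. (C * B) * (cmod (inverse (v (a k))) * E q (a k))) \<longlonglongrightarrow> (C * B) * 0"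
      by (intro tendsto_mult_left a q(1))
    then show "(\<lambda>k. (C * B) * (cmod (inverse (v (a k))) * E q (a k))) \<longlonglongrightarrow> 0" by simp
    have "eventually (\<lambda>k. cmod (\<xi> k) < 1) sequentially"
      using \<xi>0 by (rule order_tendstoD) simp
    then show "eventually (\<lambda>k. (cmod (\<xi> k) * E r (a k)) ^ (2 ^ \<nu>)
        \<le> (C * B) * (cmod (inverse (v (a k))) * E q (a k))) sequentially"
    proof eventually_elim
      case (elim k)
      have "(cmod (\<xi> k) * E r (a k)) ^ (2 ^ \<nu>) = cmod (\<xi> k) ^ (2 ^ \<nu>) * E r (a k) ^ (2 ^ \<nu>)"
        by (rule power_mult_distrib)
      also have "\<dots> \<le> cmod (\<xi> k) ^ \<nu> * (C * E q (a k))"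
        using elim q(3) E_nonneg[OF \<open>1 \<le> r\<close>]
        by (intro mult_mono power_decreasing) (auto intro: less_imp_le)
      finally show ?case by (simp add: \<xi> mult_ac)
    qed
  qed simp
  then show "(\<lambda>k. cmod (\<xi> k) * E r (a k)) \<longlonglongrightarrow> 0"
    by (rule tendsto_zero_of_power) (use E_nonneg[OF \<open>1 \<le> r\<close>] in simp)
qed

lemma index_at_top:
  assumes "(\<lambda>k. inverse (v (a k))) \<longlonglongrightarrow> 0"
  shows "filterlim a at_top sequentially"
  unfolding filterlim_at_top
proof
  fix Z
  \<comment> \<open>Finitely many nonzero numbers stay away from 0; the inserted 1 covers the empty
    case \<open>Z = 0\<close>.\<close>
  define d where "d = Min (insert 1 ((\<lambda>i. cmod (inverse (v i))) ` {..<Z}))"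
  have "0 < d" by (simp add: d_def)
  with tendsto_norm_zero[OF assms] have "eventually (\<lambda>k. cmod (inverse (v (a k))) < d) sequentially"
    by (rule order_tendstoD(2))
  then show "eventually (\<lambda>k. Z \<le> a k) sequentially"
  proof eventually_elim
    case (elim k)
    have "d \<le> cmod (inverse (v i))" if "i < Z" for i
      unfolding d_def using that by (intro Min_le) auto
    then show ?case using elim by (meson not_le)
  qed
qed

end

section \<open>Construction of the block vector\<close>

locale weighted_shift_algebra_along = weighted_shift_algebra X N w v
  for X :: "cseq set" and N :: "nat \<Rightarrow> cseq \<Rightarrow> real" and w v :: "nat \<Rightarrow> complex" +
  fixes p :: "nat \<Rightarrow> nat"
  assumes unit_tendsto: "\<And>n. limitin (seminorm_topology X N)
               (\<lambda>k. inverse (v (p k + n)) *\<^sub>s unit_seq (p k + n)) 0 sequentially"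
    and inverse_tendsto: "\<And>n. (\<lambda>k. inverse (v (p k + n))) \<longlonglongrightarrow> 0"
begin

text \<open>
  The number \<open>root_coeff \<nu> y j n\<close> is placed at index \<open>n\<close>: its \<open>\<nu>\<close>-th power is sent to \<open>y\<close>
  at index \<open>j\<close> by the shift by \<open>n - j\<close> steps.
\<close>
definition root_coeff :: "nat \<Rightarrow> complex \<Rightarrow> nat \<Rightarrow> nat \<Rightarrow> complex" where
  "root_coeff \<nu> y j n = some_root \<nu> (y * v j / v n)"

text \<open>The bound by 1 lets higher powers be estimated by lower ones. The second bound controls
  the higher powers after the block's own shift by \<open>b\<close>. The third makes the block small
  in \<open>X\<close> (case \<open>m = 0\<close>) and after the shifts belonging to earlier blocks,
  whose lengths are at most \<open>M\<close>.\<close>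

definition admissible_base :: "nat \<Rightarrow> real \<Rightarrow> nat \<Rightarrow> complex list \<Rightarrow> nat \<Rightarrow> nat \<Rightarrow> bool" where
  "admissible_base q \<delta> \<nu> ys M b \<longleftrightarrow>
     (\<forall>j<length ys. let n = b + j; \<xi> = cmod (root_coeff \<nu> (ys ! j) j n) in
        \<xi> \<le> 1 \<and> cmod (ys ! j) * \<xi> * E q j \<le> \<delta> \<and>
        (\<forall>m\<le>M. cmod (v n / v (n - m)) * \<xi> * E q (n - m) \<le> \<delta>))"

text \<open>Only finitely many smallness conditions are imposed, and each of them holds eventually
  along the bases \<open>p k\<close>, which tend to infinity.\<close>

lemma exists_admissible_base:
  assumes "1 \<le> q" "0 < \<delta>" "0 < \<nu>"
  shows "\<exists>b>B. admissible_base q \<delta> \<nu> ys M b"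
proof -
  have at_top: "filterlim (\<lambda>k. p k + j) at_top sequentially" for j
    by (rule index_at_top[OF inverse_tendsto])
  have ev: "eventually (\<lambda>k. let n = p k + j; \<xi> = cmod (root_coeff \<nu> (ys ! j) j n) in
        \<xi> \<le> 1 \<and> cmod (ys ! j) * \<xi> * E q j \<le> \<delta> \<and>
        (\<forall>m\<le>M. cmod (v n / v (n - m)) * \<xi> * E q (n - m) \<le> \<delta>)) sequentially" for j
  proof -
    define \<xi> where "\<xi> k = root_coeff \<nu> (ys ! j) j (p k + j)" for k
    have pow: "cmod (\<xi> k) ^ \<nu> = cmod (ys ! j * v j) * cmod (inverse (v (p k + j)))" for k
      using \<open>0 < \<nu>\<close>
      by (simp add: \<xi>_def root_coeff_def some_root_power norm_mult norm_divide norm_inverse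
          divide_inverse flip: norm_power)
    have unit: "(\<lambda>k. cmod (inverse (v (p k + j))) * E r (p k + j)) \<longlonglongrightarrow> 0" if "1 \<le> r" for r
    proof (rule tendstoI)
      fix e :: real assume "0 < e"
      from limitinD[OF unit_tendsto[of j] that this]
      show "eventually (\<lambda>k. dist (cmod (inverse (v (p k + j))) * E r (p k + j)) 0 < e) sequentially"
        by eventually_elim
          (use that E_nonneg[OF that] in \<open>simp add: seminorm_scale[OF that] E_def[symmetric]\<close>)
    qed
    note lims = roots_tendsto_zero[OF unit inverse_tendsto \<open>0 < \<nu>\<close> pow]
    have "eventually (\<lambda>k. cmod (\<xi> k) < 1) sequentially"
      by (rule order_tendstoD(2)[OF lims(1)]) (use assms in auto)
    moreover have "eventually (\<lambda>k. cmod (ys ! j) * E q j * cmod (\<xi> k) < \<delta>) sequentially"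
    proof (rule order_tendstoD(2))
      show "(\<lambda>k. cmod (ys ! j) * E q j * cmod (\<xi> k)) \<longlonglongrightarrow> cmod (ys ! j) * E q j * 0"
        by (intro tendsto_mult_left lims(1)[OF _ assms(1)])
    qed (use assms in simp)
    moreover have "eventually (\<lambda>k. \<forall>m\<in>{..M}. cmod (v (p k + j) / v (p k + j - m)) * cmod (\<xi> k)
        * E q (p k + j - m) \<le> \<delta>) sequentially"
    proof (rule eventually_ball_finite)
      show "\<forall>m\<in>{..M}. eventually (\<lambda>k. cmod (v (p k + j) / v (p k + j - m)) * cmod (\<xi> k)
        * E q (p k + j - m) \<le> \<delta>) sequentially"
      proof
        fix m
        \<comment> \<open>Continuity of the \<open>m\<close>-fold shift trades the size at index
          \<open>n - m\<close> for a size at index \<open>n\<close> in another seminorm, where the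
          limit for roots applies.\<close>
        obtain q' C K where C: "1 \<le> q'" "0 < C"
          "\<And>n. K \<le> n \<Longrightarrow> cmod (v n / v (n - m)) * E q (n - m) \<le> C * E q' n"
          using shift_bound[OF assms(1), of m] by blast
        have "eventually (\<lambda>k. cmod (\<xi> k) * E q' (p k + j) < \<delta> / C) sequentially"
          by (rule order_tendstoD(2)[OF lims(2)]) (use assms C in auto)
        moreover have "eventually (\<lambda>k. K \<le> p k + j) sequentially"
          using at_top[of j] unfolding filterlim_at_top by blast
        ultimately show "eventually (\<lambda>k. cmod (v (p k + j) / v (p k + j - m)) * cmod (\<xi> k)
          * E q (p k + j - m) \<le> \<delta>) sequentially"
        proof eventually_elim
          case (elim k)
          let ?n = "p k + j"
          have "cmod (v ?n / v (?n - m)) * cmod (\<xi> k) * E q (?n - m)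
            = cmod (\<xi> k) * (cmod (v ?n / v (?n - m)) * E q (?n - m))" by (simp only: mult_ac)
          also have "\<dots> \<le> cmod (\<xi> k) * (C * E q' ?n)"
            using C(3)[OF elim(2)] by (rule mult_left_mono) simp
          also have "\<dots> \<le> \<delta>" using elim(1) C(2) by (simp add: field_simps)
          finally show ?case .
        qed
      qed
    qed simp
    ultimately show ?thesis
    proof eventually_elim
      case (elim k)
      from elim(2) have "cmod (ys ! j) * cmod (\<xi> k) * E q j \<le> \<delta>" by (simp add: mult_ac)
      with elim(1,3) show ?case unfolding Let_def \<xi>_def[symmetric] by auto
    qed
  qed
  have "eventually (\<lambda>k. \<forall>j\<in>{..<length ys}. let n = p k + j; \<xi> = cmod (root_coeff \<nu> (ys ! j) j n) in
        \<xi> \<le> 1 \<and> cmod (ys ! j) * \<xi> * E q j \<le> \<delta> \<and>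
        (\<forall>m\<le>M. cmod (v n / v (n - m)) * \<xi> * E q (n - m) \<le> \<delta>)) sequentially"
    by (rule eventually_ball_finite) (use ev in auto)
  then have "eventually (\<lambda>k. admissible_base q \<delta> \<nu> ys M (p k)) sequentially"
    by (rule eventually_mono) (simp add: admissible_base_def)
  moreover have "eventually (\<lambda>k. Suc B \<le> p k) sequentially"
    using at_top[of 0] unfolding filterlim_at_top by simp
  ultimately have "eventually (\<lambda>k. admissible_base q \<delta> \<nu> ys M (p k) \<and> B < p k) sequentially"
    by eventually_elim auto
  then show ?thesis unfolding eventually_sequentially by blast
qed

text \<open>The bases are chosen inductively, each block far enough out to be harmless in
  \<open>X\<close>, after its own shift and after all earlier ones. The sequence \<open>g\<close> is
  one summable majorant for these three kinds of error, so that nothing else about the construction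
  has to be remembered.\<close>

lemma exists_block_vector:
  fixes ys :: "nat \<Rightarrow> complex list" and \<nu> :: "nat \<Rightarrow> nat"
  assumes \<nu>: "\<And>l. 0 < \<nu> l"
  obtains b :: "nat \<Rightarrow> nat" and x :: cseq and g :: "nat \<Rightarrow> real" where
    "\<And>n. 0 \<le> g n"
    "\<And>k K. (\<Sum>n=b k..<K. g n) \<le> 2 * (1/2) ^ k"
    "\<And>n. cmod (x n) \<le> 1"
    "\<And>k n. b k \<le> n \<Longrightarrow> cmod (x n) * E (Suc k) n \<le> g n"
    "\<And>k j. length (ys k) \<le> j \<Longrightarrow>
       cmod (v (b k + j) / v j) * cmod (x (b k + j)) * E (Suc k) j \<le> g (b k + j)"
    "\<And>k j. j < length (ys k) \<Longrightarrow> x (b k + j) ^ \<nu> k = ys k ! j * v j / v (b k + j)"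
    "\<And>k j. j < length (ys k) \<Longrightarrow>
       cmod (ys k ! j) * cmod (x (b k + j)) * E (Suc k) j \<le> g (b k + j)"
proof -
  define d where "d l = length (ys l)" for l
  \<comment> \<open>A block of length \<open>d l\<close> then contributes at most
    \<open>(1/2) ^ l\<close> to the sum of \<open>g\<close>; the added 1 avoids division by zero for
    an empty list.\<close>
  define \<delta> :: "nat \<Rightarrow> real" where "\<delta> l = (1/2) ^ l / (d l + 1)" for l
  have \<delta>pos: "0 < \<delta> l" for l by (simp add: \<delta>_def)
  \<comment> \<open>Block \<open>l\<close> is controlled in the seminorm \<open>Suc l\<close>, since
    seminorms are indexed from 1.\<close>
  define adm where "adm l = admissible_base (Suc l) (\<delta> l) (\<nu> l) (ys l)" for l
  have adm_mono: "adm l M' c" if "adm l M c" "M' \<le> M" for l M M' c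
    using that unfolding adm_def admissible_base_def Let_def by (meson le_trans)
  have ex: "\<exists>c>B. adm l M c" for l B M
    unfolding adm_def by (rule exists_admissible_base) (use \<delta>pos \<nu> in auto)
  \<comment> \<open>Taking the previous base as the bound \<open>M\<close> covers the shifts by all
    earlier bases at once, and the gap condition keeps the blocks disjoint. The clause with
    \<open>M = 0\<close> is kept separately because block 0 has no predecessor.\<close>
  have "\<exists>b. \<forall>l. adm l 0 (b l) \<and> adm (Suc l) (b l) (b (Suc l)) \<and> b l + d l < b (Suc l)"
  proof (rule dependent_nat_choice)
    show "\<exists>c. adm 0 0 c" using ex by blast
    show "\<exists>c. adm (Suc l) 0 c \<and> adm (Suc l) a c \<and> a + d l < c" for a l
    proof -
      obtain c where "a + d l < c" "adm (Suc l) a c" using ex by blast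
      moreover from this(2) have "adm (Suc l) 0 c" by (rule adm_mono) simp
      ultimately show ?thesis by blast
    qed
  qed
  then obtain b where b: "\<And>l. adm l 0 (b l)" "\<And>l. adm (Suc l) (b l) (b (Suc l))"
    "\<And>l. b l + d l < b (Suc l)" by blast
  have "b l < b (Suc l)" for l using b(3)[of l] by simp
  then have sm: "strict_mono b" by (simp add: strict_mono_Suc_iff)
  define block where "block l n \<longleftrightarrow> b l \<le> n \<and> n < b l + d l" for l n
  have block_ge: "k \<le> l" if "block l n" "b k \<le> n" for k l n
  proof (rule ccontr)
    assume "\<not> k \<le> l"
    then have "b (Suc l) \<le> b k" using strict_mono_less_eq[OF sm] by simp
    then show False using that b(3)[of l] by (simp add: block_def)
  qed
  have block_unique: "k = l" if "block k n" "block l n" for k l n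
    using block_ge[OF that(1), of l] block_ge[OF that(2), of k] that by (simp add: block_def)
  \<comment> \<open>Disjointness of the blocks gives \<open>THE\<close> its meaning; between blocks
    both \<open>x\<close> and \<open>g\<close> vanish.\<close>
  define x where "x n = (if \<exists>l. block l n then
      let l = THE l. block l n in root_coeff (\<nu> l) (ys l ! (n - b l)) (n - b l) n else 0)" for n
  define g where "g n = (if \<exists>l. block l n then \<delta> (THE l. block l n) else 0)" for n
  have x_block: "x n = root_coeff (\<nu> l) (ys l ! (n - b l)) (n - b l) n"
    and g_block: "g n = \<delta> l" if "block l n" for l n
  proof -
    have "(THE l. block l n) = l" using that block_unique by blast
    then show "x n = root_coeff (\<nu> l) (ys l ! (n - b l)) (n - b l) n" "g n = \<delta> l"
      using that by (auto simp: x_def g_def)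
  qed
  have x_out: "x n = 0" and g_out: "g n = 0" if "\<nexists>l. block l n" for n
    using that by (simp_all add: x_def g_def)
  have g_nonneg: "0 \<le> g n" for n
    using \<delta>pos by (simp add: g_def less_imp_le)
  have x_le: "cmod (x n) \<le> 1"
    and x_self: "cmod (ys l ! (n - b l)) * cmod (x n) * E (Suc l) (n - b l) \<le> \<delta> l"
    and x_shift: "(m = 0 \<or> (\<exists>k<l. m = b k)) \<Longrightarrow>
       cmod (v n / v (n - m)) * cmod (x n) * E (Suc l) (n - m) \<le> \<delta> l" if "block l n" for l n m
  proof -
    have n: "b l + (n - b l) = n" "n - b l < length (ys l)"
      using that by (auto simp: block_def d_def)
    show "cmod (x n) \<le> 1" "cmod (ys l ! (n - b l)) * cmod (x n) * E (Suc l) (n - b l) \<le> \<delta> l"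
      using b(1)[of l] n unfolding adm_def admissible_base_def Let_def x_block[OF that] by metis+
    assume m: "m = 0 \<or> (\<exists>k<l. m = b k)"
    \<comment> \<open>An earlier base is at most the base immediately preceding block
      \<open>l\<close>, which was the bound \<open>M\<close> when block \<open>l\<close> was
      placed.\<close>
    have "\<exists>M. m \<le> M \<and> adm l M (b l)"
    proof (cases "m = 0")
      case True
      then show ?thesis using b(1) by blast
    next
      case False
      then obtain k where k: "k < l" "m = b k" using m by blast
      then obtain l' where l': "l = Suc l'" "k \<le> l'" by (cases l) auto
      then have "m \<le> b l'" using strict_mono_less_eq[OF sm] k by simp
      then show ?thesis using b(2)[of l'] l' by blast
    qed
    then show "cmod (v n / v (n - m)) * cmod (x n) * E (Suc l) (n - m) \<le> \<delta> l"
      using n unfolding adm_def admissible_base_def Let_def x_block[OF that] by metis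
  qed
  have E_le: "a * E (Suc k) j \<le> a * E (Suc l) j" if "k \<le> l" "0 \<le> a" for a k l j
    using that by (intro mult_left_mono E_mono) auto
  have sum_block: "(\<Sum>n=b l..<b (Suc l). g n) \<le> (1/2) ^ l" for l
  proof -
    have "(\<Sum>n=b l..<b (Suc l). g n) = (\<Sum>n=b l..<b l + d l. g n)"
    proof (rule sum.mono_neutral_right)
      show "\<forall>n\<in>{b l..<b (Suc l)} - {b l..<b l + d l}. g n = 0"
      proof
        fix n assume n: "n \<in> {b l..<b (Suc l)} - {b l..<b l + d l}"
        have False if "block k n" for k
        proof -
          have "l \<le> k" using block_ge[OF that] n by simp
          moreover have "k \<noteq> l" using that n by (auto simp: block_def)
          ultimately have "b (Suc l) \<le> b k" using strict_mono_less_eq[OF sm] by simp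
          then show False using that n by (auto simp: block_def)
        qed
        then show "g n = 0" by (intro g_out) blast
      qed
    qed (use b(3)[of l] in auto)
    also have "\<dots> = (\<Sum>n=b l..<b l + d l. \<delta> l)"
      by (intro sum.cong g_block) (auto simp: block_def)
    also have "\<dots> = d l * \<delta> l" by simp
    also have "\<dots> = (1/2) ^ l * (d l / (d l + 1))" by (simp add: \<delta>_def)
    also have "\<dots> \<le> (1/2) ^ l * 1" by (rule mult_left_mono) auto
    finally show ?thesis by simp
  qed
  \<comment> \<open>The subtracted term makes the induction close: passing from \<open>k + i\<close>
    to its successor frees exactly \<open>(1/2) ^ (k + i)\<close>.\<close>
  have sum_blocks: "(\<Sum>n=b k..<b (k + i). g n) \<le> 2 * (1/2) ^ k - 2 * (1/2) ^ (k + i)" for k i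
  proof (induction i)
    case (Suc i)
    have "(\<Sum>n=b k..<b (k + Suc i). g n)
      = (\<Sum>n=b k..<b (k + i). g n) + (\<Sum>n=b (k + i)..<b (k + Suc i). g n)"
      by (rule sum.atLeastLessThan_concat[symmetric]) (simp_all add: strict_mono_less_eq[OF sm])
    then show ?case using Suc sum_block[of "k + i"] by simp
  qed simp
  show thesis
  proof (rule that[of g b x])
    show "0 \<le> g n" for n by (rule g_nonneg)
    show "(\<Sum>n=b k..<K. g n) \<le> 2 * (1/2) ^ k" for k K
    proof -
      have "K \<le> b (k + K)"
        using strict_mono_imp_increasing[OF sm, of "k + K"] by simp
      then have "(\<Sum>n=b k..<K. g n) \<le> (\<Sum>n=b k..<b (k + K). g n)"
        by (intro sum_mono2) (use g_nonneg in auto)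
      also have "\<dots> \<le> 2 * (1/2) ^ k - 2 * (1/2) ^ (k + K)" by (rule sum_blocks)
      finally show ?thesis by (smt (verit) zero_le_power divide_nonneg_nonneg)
    qed
    show "cmod (x n) \<le> 1" for n
      using x_le x_out by (cases "\<exists>l. block l n") auto
    show "cmod (x n) * E (Suc k) n \<le> g n" if "b k \<le> n" for k n
    proof (cases "\<exists>l. block l n")
      case True
      then obtain l where l: "block l n" by blast
      have "cmod (x n) * E (Suc k) n \<le> cmod (x n) * E (Suc l) n"
        using block_ge[OF l that] by (rule E_le) simp
      then show ?thesis using x_shift[OF l, of 0] g_block[OF l] by simp
    qed (simp add: x_out g_out)
    show "cmod (v (b k + j) / v j) * cmod (x (b k + j)) * E (Suc k) j \<le> g (b k + j)"
      if "length (ys k) \<le> j" for k j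
    \<comment> \<open>Beyond the list of block \<open>k\<close> only blocks with
      \<open>l > k\<close> can be met, and for these the shift by \<open>b k\<close> was taken into
      account.\<close>
    proof (cases "\<exists>l. block l (b k + j)")
      case True
      then obtain l where l: "block l (b k + j)" by blast
      have "k \<le> l" using block_ge[OF l, of k] by simp
      moreover have "k \<noteq> l" using l that by (auto simp: block_def d_def)
      ultimately have "k < l" by simp
      have "cmod (v (b k + j) / v j) * cmod (x (b k + j)) * E (Suc k) j
          \<le> cmod (v (b k + j) / v j) * cmod (x (b k + j)) * E (Suc l) j"
        using \<open>k \<le> l\<close> by (rule E_le) simp
      also have "\<dots> \<le> \<delta> l"
        using x_shift[OF l, of "b k"] \<open>k < l\<close> by auto
      finally show ?thesis using g_block[OF l] by simp
    qed (simp add: x_out g_out)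
    fix k j assume "j < length (ys k)"
    then have l: "block k (b k + j)" by (simp add: block_def d_def)
    show "x (b k + j) ^ \<nu> k = ys k ! j * v j / v (b k + j)"
      using \<nu> by (simp add: x_block[OF l] root_coeff_def some_root_power)
    show "cmod (ys k ! j) * cmod (x (b k + j)) * E (Suc k) j \<le> g (b k + j)"
      using x_self[OF l] g_block[OF l] by simp
  qed
qed

end

section \<open>Recurring enumeration of targets and exponents, and approximation by lists\<close>

lemma exists_lists_enumeration:
  assumes "countable D" "D \<noteq> {}"
  shows "\<exists>(ys :: nat \<Rightarrow> 'a list) (\<nu> :: nat \<Rightarrow> nat). (\<forall>l. 0 < \<nu> l) \<and>
    (\<forall>zs\<in>lists D. \<forall>n>0. \<forall>k. \<exists>l\<ge>k. ys l = zs \<and> \<nu> l = n)"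
proof -
  \<comment> \<open>The third component is a mere counter: its infinitely many values force every
    pair to recur at infinitely many positions.\<close>
  define A where "A = lists D \<times> {0::nat<..} \<times> (UNIV :: nat set)"
  define F where "F = from_nat_into A"
  have "countable A" unfolding A_def by (intro countable_SIGMA countable_lists assms) auto
  moreover have "A \<noteq> {}" unfolding A_def by blast
  ultimately have F: "range F = A" unfolding F_def by (intro range_from_nat_into)
  have "0 < fst (snd (F l))" for l
    using rangeI[of F l] unfolding F by (auto simp: A_def)
  moreover have "\<exists>l\<ge>k. fst (F l) = zs \<and> fst (snd (F l)) = n"
    if "zs \<in> lists D" "0 < n" for zs n k
  proof -
    have "(zs, n, t) \<in> range F" for t unfolding F using that by (simp add: A_def)
    then have "\<exists>l. F l = (zs, n, t)" for t by (metis imageE)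
    then obtain l where l: "\<And>t. F (l t) = (zs, n, t)" by metis
    have "inj l" by (rule injI) (metis l prod.inject)
    then have "infinite (range l)" by (rule range_inj_infinite)
    then obtain t where "k \<le> l t" by (auto simp: infinite_nat_iff_unbounded_le)
    then show ?thesis using l by (intro exI[of _ "l t"]) auto
  qed
  ultimately show ?thesis
    by (intro exI[of _ "\<lambda>l. fst (F l)"] exI[of _ "\<lambda>l. fst (snd (F l))"]) blast
qed

lemma exists_list_approx:
  fixes a :: "nat \<Rightarrow> 'a::metric_space"
  assumes dense: "\<And>U::'a set. open U \<Longrightarrow> U \<noteq> {} \<Longrightarrow> \<exists>d\<in>D. d \<in> U" and "\<And>j. 0 < \<delta> j"
  obtains zs where "zs \<in> lists D" "length zs = K" "\<And>j. j < K \<Longrightarrow> dist (a j) (zs ! j) < \<delta> j"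
proof -
  have "\<exists>d\<in>D. dist (a j) d < \<delta> j" for j
    using dense[of "ball (a j) (\<delta> j)"] assms(2)[of j] by auto
  then obtain h where "\<And>j. h j \<in> D" "\<And>j. dist (a j) (h j) < \<delta> j" by metis
  then show thesis by (intro that[of "map h [0..<K]"]) auto
qed

section \<open>Hypercyclicity of the polynomials in the block vector\<close>

context weighted_shift_algebra_along
begin

text \<open>At a block whose exponent is the lowest degree of the polynomial, the corresponding
  shift yields the block's list times the lowest coefficient, up to an error governed by
  \<open>g\<close>. Recurrence of the pairs allows such a block to be taken arbitrarily late, which
  makes the error small in any given seminorm.\<close>

lemma polynomial_of_block_vector_hypercyclic:
  fixes D :: "complex set" and ys :: "nat \<Rightarrow> complex list" and \<nu> b :: "nat \<Rightarrow> nat"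
    and x :: cseq and g :: "nat \<Rightarrow> real"
  assumes dense: "\<And>U. open U \<Longrightarrow> U \<noteq> {} \<Longrightarrow> \<exists>d\<in>D. d \<in> U"
    and ys: "\<And>zs n k. zs \<in> lists D \<Longrightarrow> 0 < n \<Longrightarrow> \<exists>l\<ge>k. ys l = zs \<and> \<nu> l = n"
    and g_nonneg: "\<And>n. 0 \<le> g n"
    and g_sum: "\<And>k K. (\<Sum>n=b k..<K. g n) \<le> 2 * (1/2) ^ k"
    and x_le: "\<And>n. cmod (x n) \<le> 1"
    and x_E: "\<And>k n. b k \<le> n \<Longrightarrow> cmod (x n) * E (Suc k) n \<le> g n"
    and x_tail: "\<And>k j. length (ys k) \<le> j \<Longrightarrow>
       cmod (v (b k + j) / v j) * cmod (x (b k + j)) * E (Suc k) j \<le> g (b k + j)"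
    and x_power: "\<And>k j. j < length (ys k) \<Longrightarrow> x (b k + j) ^ \<nu> k = ys k ! j * v j / v (b k + j)"
    and x_self: "\<And>k j. j < length (ys k) \<Longrightarrow>
       cmod (ys k ! j) * cmod (x (b k + j)) * E (Suc k) j \<le> g (b k + j)"
    and c: "\<exists>\<mu>\<in>{1..M}. c \<mu> \<noteq> 0"
  shows "(\<Sum>\<mu>=1..M. c \<mu> *\<^sub>s x ^ \<mu>) \<in> HC X N (backward_shift w)"
proof -
  let ?T = "backward_shift w"
  have "x \<in> X"
  proof (rule mem_of_summable)
    fix q :: nat assume q: "1 \<le> q"
    have "summable g"
    proof (rule bounded_imp_summable)
      fix K
      have "(\<Sum>n\<le>K. g n) \<le> (\<Sum>n\<in>{..<b 0} \<union> {b 0..<Suc K}. g n)"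
        by (rule sum_mono2) (use g_nonneg in auto)
      also have "\<dots> = (\<Sum>n<b 0. g n) + (\<Sum>n=b 0..<Suc K. g n)"
        by (rule sum.union_disjoint) auto
      also have "\<dots> \<le> (\<Sum>n<b 0. g n) + 2" using g_sum[of 0 "Suc K"] by simp
      finally show "(\<Sum>n\<le>K. g n) \<le> (\<Sum>n<b 0. g n) + 2" .
    qed (rule g_nonneg)
    then show "summable (\<lambda>n. cmod (x n) * E q n)"
    proof (rule summable_comparison_test_ev[rotated])
      show "eventually (\<lambda>n. norm (cmod (x n) * E q n) \<le> g n) sequentially"
        \<comment> \<open>The assumption \<open>x_E\<close> at \<open>k = q - 1\<close> is the one
          that speaks of \<open>E q\<close>.\<close>
        using eventually_ge_at_top[of "b (q - 1)"]
        by eventually_elim (use x_E[of "q - 1"] q E_nonneg[OF q] in simp)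
    qed
  qed
  have power_mem: "x ^ \<mu> \<in> X" if "1 \<le> \<mu>" for \<mu>
    using that
  proof (induction \<mu> rule: dec_induct)
    case base
    then show ?case using \<open>x \<in> X\<close> by (simp only: power_one_right)
  next
    case (step n)
    then show ?case unfolding power_Suc using mult_mem \<open>x \<in> X\<close> by blast
  qed
  define y where "y = (\<Sum>\<mu>=1..M. c \<mu> *\<^sub>s x ^ \<mu>)"
  have y_mem: "y \<in> X" unfolding y_def by (intro mem_intros power_mem) simp
  have y_apply: "y n = (\<Sum>\<mu>=1..M. c \<mu> * x n ^ \<mu>)" for n
    by (simp add: y_def sum_apply power_fun_apply)
  define \<nu>0 where "\<nu>0 = (LEAST \<mu>. \<mu> \<in> {1..M} \<and> c \<mu> \<noteq> 0)"
  have \<nu>0: "\<nu>0 \<in> {1..M}" "c \<nu>0 \<noteq> 0"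
    using c LeastI_ex[of "\<lambda>\<mu>. \<mu> \<in> {1..M} \<and> c \<mu> \<noteq> 0"] unfolding \<nu>0_def by blast+
  have below: "c \<mu> = 0" if "\<mu> \<in> {1..M}" "\<mu> < \<nu>0" for \<mu>
    using not_less_Least that unfolding \<nu>0_def by blast
  define C where "C = (\<Sum>\<mu>=1..M. cmod (c \<mu>))"
  have "0 \<le> C" by (simp add: C_def sum_nonneg)
  \<comment> \<open>The restriction \<open>q \<le> Suc k\<close> reflects that the bounds for block
    \<open>k\<close> are stated in the seminorm \<open>Suc k\<close>, which dominates all earlier
    ones.\<close>
  have approx: "N q ((?T ^^ b k) y - c \<nu>0 *\<^sub>s (\<Sum>j<length (ys k). ys k ! j *\<^sub>s unit_seq j))
      \<le> C * (2 * (1/2) ^ k)" if k: "\<nu> k = \<nu>0" and q: "1 \<le> q" "q \<le> Suc k" for k q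
  proof (rule seminorm_le_of_coordinates)
    let ?z = "(?T ^^ b k) y - c \<nu>0 *\<^sub>s (\<Sum>j<length (ys k). ys k ! j *\<^sub>s unit_seq j)"
    show "?z \<in> X" by (intro mem_intros funpow_shift_mem y_mem unit_seq_mem)
    have coord: "cmod (?z j) * E q j \<le> C * g (b k + j)" for j
    proof -
      let ?n = "b k + j"
      let ?r = "v ?n / v j"
      have z: "?z j = ?r * y ?n - c \<nu>0 * (if j < length (ys k) then ys k ! j else 0)"
        by (simp add: funpow_shift_apply sum_unit_seq_apply add.commute)
      have "cmod (?z j) * E (Suc k) j \<le> C * g ?n"
      proof (cases "j < length (ys k)")
        case False
        have "cmod (y ?n) \<le> (\<Sum>\<mu>=1..M. cmod (c \<mu>) * cmod (x ?n))"
          unfolding y_apply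
        proof (rule sum_norm_le)
          fix \<mu> assume "\<mu> \<in> {1..M}"
          then have "cmod (x ?n) ^ \<mu> \<le> cmod (x ?n) ^ 1"
            by (intro power_decreasing x_le) auto
          then show "cmod (c \<mu> * x ?n ^ \<mu>) \<le> cmod (c \<mu>) * cmod (x ?n)"
            by (simp add: norm_mult norm_power mult_left_mono)
        qed
        then have "cmod (y ?n) \<le> C * cmod (x ?n)" by (simp add: C_def sum_distrib_right)
        then have "cmod ?r * cmod (y ?n) * E (Suc k) j \<le> cmod ?r * (C * cmod (x ?n)) * E (Suc k) j"
          by (intro mult_right_mono mult_left_mono E_nonneg) auto
        also have "\<dots> = C * (cmod ?r * cmod (x ?n) * E (Suc k) j)" by (simp only: mult_ac)
        also have "\<dots> \<le> C * g ?n"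
          using x_tail[of k j] False \<open>0 \<le> C\<close> by (intro mult_left_mono) auto
        finally have "cmod ?r * cmod (y ?n) * E (Suc k) j \<le> C * g ?n" .
        moreover have "cmod (?z j) = cmod ?r * cmod (y ?n)"
          unfolding z using False by (simp add: norm_mult norm_divide)
        ultimately show ?thesis by (simp only:)
      next
        case True
        let ?a = "ys k ! j"
        have main: "?r * x ?n ^ \<nu>0 = ?a" using x_power[OF True] by (simp add: k)
        have "?z j = (\<Sum>\<mu>=1..M. c \<mu> * (?r * x ?n ^ \<mu>)) - c \<nu>0 * ?a"
          unfolding z y_apply using True by (simp add: sum_distrib_left mult_ac)
        also have "\<dots> = (\<Sum>\<mu>\<in>{1..M} - {\<nu>0}. c \<mu> * (?r * x ?n ^ \<mu>))"
          using \<nu>0(1) by (subst sum.remove[of _ \<nu>0]) (simp_all only: main finite_atLeastAtMost add_diff_cancel_left')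
        finally have "cmod (?z j) \<le> (\<Sum>\<mu>\<in>{1..M} - {\<nu>0}. cmod (c \<mu>) * (cmod ?a * cmod (x ?n)))"
        proof (elim ssubst, intro sum_norm_le)
          fix \<mu> assume \<mu>: "\<mu> \<in> {1..M} - {\<nu>0}"
          show "cmod (c \<mu> * (?r * x ?n ^ \<mu>)) \<le> cmod (c \<mu>) * (cmod ?a * cmod (x ?n))"
          proof (cases "\<mu> < \<nu>0")
            case True
            then show ?thesis using below \<mu> by simp
          next
            case False
            then have "\<nu>0 < \<mu>" using \<mu> by auto
            \<comment> \<open>The power of degree \<open>\<nu>0\<close> absorbs the weight quotient
              and leaves the list entry; at least one surplus factor \<open>x ?n\<close> remains, as
              \<open>x_self\<close> requires.\<close>
            then have "?r * x ?n ^ \<mu> = (?r * x ?n ^ \<nu>0) * x ?n ^ (\<mu> - \<nu>0)"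
              by (simp flip: power_add)
            then have "cmod (?r * x ?n ^ \<mu>) = cmod ?a * cmod (x ?n) ^ (\<mu> - \<nu>0)"
              unfolding main by (simp only: norm_mult norm_power)
            moreover have "cmod (x ?n) ^ (\<mu> - \<nu>0) \<le> cmod (x ?n) ^ 1"
              using \<open>\<nu>0 < \<mu>\<close> by (intro power_decreasing x_le) auto
            ultimately have "cmod (?r * x ?n ^ \<mu>) \<le> cmod ?a * cmod (x ?n)"
              by (simp add: mult_left_mono)
            then show ?thesis unfolding norm_mult[of "c \<mu>"] by (rule mult_left_mono) simp
          qed
        qed
        also have "\<dots> \<le> (\<Sum>\<mu>=1..M. cmod (c \<mu>) * (cmod ?a * cmod (x ?n)))"
          by (rule sum_mono2) auto
        also have "\<dots> = C * (cmod ?a * cmod (x ?n))"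
          unfolding C_def by (rule sum_distrib_right[symmetric])
        finally have "cmod (?z j) * E (Suc k) j \<le> C * (cmod ?a * cmod (x ?n)) * E (Suc k) j"
          by (rule mult_right_mono) (simp add: E_nonneg)
        also have "\<dots> = C * (cmod ?a * cmod (x ?n) * E (Suc k) j)" by (simp only: mult_ac)
        also have "\<dots> \<le> C * g ?n" using x_self[OF True] \<open>0 \<le> C\<close> by (rule mult_left_mono)
        finally show ?thesis .
      qed
      moreover have "cmod (?z j) * E q j \<le> cmod (?z j) * E (Suc k) j"
        using q by (intro mult_left_mono E_mono) auto
      ultimately show ?thesis by linarith
    qed
    fix J
    have "(\<Sum>j<J. cmod (?z j) * E q j) \<le> (\<Sum>j<J. C * g (b k + j))"
      by (rule sum_mono) (rule coord)
    also have "\<dots> = C * (\<Sum>n=b k..<J + b k. g n)"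
      using sum.shift_bounds_nat_ivl[of g 0 "b k" J]
      by (simp add: sum_distrib_left atLeast0LessThan add.commute)
    also have "\<dots> \<le> C * (2 * (1/2) ^ k)" using g_sum \<open>0 \<le> C\<close> by (rule mult_left_mono)
    finally show "(\<Sum>j<J. cmod (?z j) * E q j) \<le> C * (2 * (1/2) ^ k)" .
  qed (rule q(1))
  have "seminorm_topology X N closure_of (range (\<lambda>n. (?T ^^ n) y)) = X"
  proof (rule closure_of_eq_carrier)
    show "range (\<lambda>n. (?T ^^ n) y) \<subseteq> X" using funpow_shift_mem[OF y_mem] by blast
    fix z and q :: nat and e :: real
    assume z: "z \<in> X" and q: "1 \<le> q" and "0 < e"
    define S where "S K = (\<Sum>n<K. z n *\<^sub>s unit_seq n)" for K
    obtain K where K: "N q (S K - z) < e / 3"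
      using limitinD[OF expansion[OF z] q, of "e / 3"] \<open>0 < e\<close>
      unfolding eventually_sequentially S_def by auto
    \<comment> \<open>This tolerance makes each of the \<open>K\<close> coordinates cost at most
      \<open>e / 3 / (K + 1)\<close> after multiplication by \<open>c \<nu>0\<close> and weighting
      by \<open>E q j\<close>; the added ones keep the denominators positive. The list approximates
      \<open>z j / c \<nu>0\<close> because the orbit reproduces it multiplied by
      \<open>c \<nu>0\<close>.\<close>
    define \<delta> where "\<delta> j = e / 3 / (K + 1) / cmod (c \<nu>0) / (E q j + 1)" for j
    have "0 < \<delta> j" for j
      using \<open>0 < e\<close> \<nu>0 E_nonneg[OF q, of j] by (simp add: \<delta>_def)
    then obtain zs where zs: "zs \<in> lists D" "length zs = K"
      "\<And>j. j < K \<Longrightarrow> dist (z j / c \<nu>0) (zs ! j) < \<delta> j"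
      using exists_list_approx[OF dense, of \<delta> K "\<lambda>j. z j / c \<nu>0"] by blast
    define u where "u = c \<nu>0 *\<^sub>s (\<Sum>j<K. zs ! j *\<^sub>s unit_seq j)"
    have "u - S K = (\<Sum>j<K. (c \<nu>0 * zs ! j - z j) *\<^sub>s unit_seq j)"
      by (simp only: u_def S_def cseq.scale_sum_right cseq.scale_scale cseq.scale_left_diff_distrib
          sum_subtractf)
    then have "N q (u - S K) \<le> (\<Sum>j<K. cmod (c \<nu>0 * zs ! j - z j) * E q j)"
      using seminorm_sum_unit_seq_le[OF q] by simp
    also have "\<dots> \<le> (\<Sum>j<K. e / 3 / (K + 1))"
    proof (rule sum_mono)
      fix j assume "j \<in> {..<K}"
      have "c \<nu>0 * zs ! j - z j = c \<nu>0 * (zs ! j - z j / c \<nu>0)"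
        using \<nu>0 by (simp add: field_simps)
      then have "cmod (c \<nu>0 * zs ! j - z j) = cmod (c \<nu>0) * dist (z j / c \<nu>0) (zs ! j)"
        by (simp only: norm_mult dist_norm norm_minus_commute)
      also have "\<dots> \<le> cmod (c \<nu>0) * \<delta> j"
        using zs(3)[of j] \<open>j \<in> {..<K}\<close> by (intro mult_left_mono) auto
      also have "\<dots> = e / 3 / (K + 1) / (E q j + 1)" using \<nu>0 by (simp add: \<delta>_def)
      finally have "cmod (c \<nu>0 * zs ! j - z j) * E q j
          \<le> e / 3 / (K + 1) / (E q j + 1) * (E q j + 1)"
        using E_nonneg[OF q, of j] \<open>0 < e\<close> by (intro mult_mono) auto
      also have "\<dots> = e / 3 / (K + 1)" using E_nonneg[OF q, of j] by simp
      finally show "cmod (c \<nu>0 * zs ! j - z j) * E q j \<le> e / 3 / (K + 1)" .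
    qed
    also have "\<dots> \<le> e / 3" using \<open>0 < e\<close> by (simp add: field_simps)
    finally have uS: "N q (u - S K) \<le> e / 3" .
    have "(\<lambda>k. C * (2 * (1/2) ^ k)) \<longlonglongrightarrow> C * (2 * 0)"
      by (intro tendsto_mult_left LIMSEQ_power_zero) simp
    then have "eventually (\<lambda>k. C * (2 * (1/2) ^ k) < e / 3) sequentially"
      by (rule order_tendstoD(2)) (use \<open>0 < e\<close> in simp)
    then obtain k0 where k0: "\<And>k. k0 \<le> k \<Longrightarrow> C * (2 * (1/2) ^ k) < e / 3"
      unfolding eventually_sequentially by blast
    \<comment> \<open>Recurrence is used here: \<open>k \<ge> k0\<close> makes the error small, and
      \<open>k \<ge> q\<close> makes \<open>approx\<close> available for the seminorm
      \<open>q\<close>.\<close>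
    obtain k where k: "max k0 q \<le> k" "ys k = zs" "\<nu> k = \<nu>0"
      using ys[OF zs(1), of \<nu>0 "max k0 q"] \<nu>0(1) by auto
    have Tu: "N q ((?T ^^ b k) y - u) < e / 3"
      using approx[OF k(3) q] k0[of k] k(1) unfolding u_def k(2) zs(2) by simp
    have mem: "(?T ^^ b k) y \<in> X" "u \<in> X" "S K \<in> X"
      unfolding u_def S_def by (intro mem_intros funpow_shift_mem y_mem unit_seq_mem)+
    have "N q ((?T ^^ b k) y - z) \<le> N q ((?T ^^ b k) y - u) + N q (u - z)"
      using mem z by (intro seminorm_triangle_diff q)
    also have "N q (u - z) \<le> N q (u - S K) + N q (S K - z)"
      using mem z by (intro seminorm_triangle_diff q)
    finally have "N q ((?T ^^ b k) y - z) < e" using Tu uS K by linarith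
    then show "\<exists>y'\<in>range (\<lambda>n. (?T ^^ n) y). N q (y' - z) < e" by blast
  qed
  then show "(\<Sum>\<mu>=1..M. c \<mu> *\<^sub>s x ^ \<mu>) \<in> HC X N ?T"
    using y_mem by (simp only: HC_def y_def[symmetric] mem_Collect_eq simp_thms)
qed

section \<open>From the block vector to the generated algebra\<close>

lemma exists_hypercyclic_algebra:
  "\<exists>x. \<forall>c M. (\<exists>\<mu>\<in>{1..M}. c \<mu> \<noteq> 0) \<longrightarrow>
    (\<Sum>\<mu>=1..M. c \<mu> *\<^sub>s x ^ \<mu>) \<in> HC X N (backward_shift w)"
proof -
  obtain D :: "complex set" where D: "countable D"
    "\<And>U. open U \<Longrightarrow> U \<noteq> {} \<Longrightarrow> \<exists>d\<in>D. d \<in> U"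
    using countable_dense_exists[where ?'a = complex] by metis
  have "D \<noteq> {}" using D(2)[of UNIV] by auto
  from exists_lists_enumeration[OF D(1) this] show ?thesis
  proof (elim exE conjE)
    fix ys :: "nat \<Rightarrow> complex list" and \<nu> :: "nat \<Rightarrow> nat"
    assume \<nu>: "\<forall>l. 0 < \<nu> l"
      and ys: "\<forall>zs\<in>lists D. \<forall>n>0. \<forall>k. \<exists>l\<ge>k. ys l = zs \<and> \<nu> l = n"
    show ?thesis
      by (rule exists_block_vector[of \<nu> ys], rule \<nu>[rule_format], intro exI allI impI,
        rule polynomial_of_block_vector_hypercyclic[OF D(2) ys[rule_format]])
  qed
qed

end

theorem theorem2p6:
  fixes X :: "cseq set" and N :: "nat \<Rightarrow> cseq \<Rightarrow> real"
    and w v :: "nat \<Rightarrow> complex" and p :: "nat \<Rightarrow> nat"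
  assumes "frechet_sequence_algebra X N"
    and "schauder_basis X N unit_seq"
    and "property_A X N"
    and "weighted_backward_shift_on X w"
    and "hypercyclic X N (backward_shift w)"
    and "\<And>n. v n = (\<Prod>k=0..n. w k)"
    and "mono p"
    and "\<And>n. limitin (seminorm_topology X N)
               (\<lambda>k. inverse (v (p k + n)) *\<^sub>s unit_seq (p k + n)) 0 sequentially"
    and "\<And>n. (\<lambda>k. \<Prod>\<nu>=0..p k + n. inverse (w \<nu>)) \<longlonglongrightarrow> 0"
  shows "\<exists>x \<in> HC X N (backward_shift w).
           generated_algebra x - {0} \<subseteq> HC X N (backward_shift w)"
proof -
  interpret frechet_sequence_algebra X N by fact
  interpret weighted_shift_algebra_along X N w v p
  proof unfold_locales
    show "(\<lambda>k. inverse (v (p k + n))) \<longlonglongrightarrow> 0" for n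
      using assms(9)[of n] by (simp only: assms(6) prod_inversef[symmetric] o_def)
  qed (fact assms)+
  obtain x where "\<forall>c M. (\<exists>\<mu>\<in>{1..M}. c \<mu> \<noteq> 0) \<longrightarrow>
    (\<Sum>\<mu>=1..M. c \<mu> *\<^sub>s x ^ \<mu>) \<in> HC X N (backward_shift w)"
    using exists_hypercyclic_algebra by (rule exE)
  note x = this[rule_format]
  have "x \<in> HC X N (backward_shift w)"
    using x[of 1 "\<lambda>_. 1"] by simp
  moreover have "y \<in> HC X N (backward_shift w)" if y: "y \<in> generated_algebra x" "y \<noteq> 0" for y
  proof -
    obtain c M where y_eq: "y = (\<Sum>\<mu>=1..M. c \<mu> *\<^sub>s x ^ \<mu>)"
      using y(1) unfolding generated_algebra_eq by blast
    have "\<exists>\<mu>\<in>{1..M}. c \<mu> \<noteq> 0"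
    proof (rule ccontr)
      assume "\<not> ?thesis"
      then have "y = 0" unfolding y_eq by (intro sum.neutral) simp
      with y(2) show False by simp
    qed
    then show ?thesis unfolding y_eq by (rule x)
  qed
  ultimately show ?thesis by blast
qed

end
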